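(* For every $\epsilon > 0$ there is an algorithm for the problem of maximizing a DR-submodular function $f:[0,1]^n \to \mathbb{R}_+$ over $[0,1]^n$ with the following guarantees: (i) the algorithm is deterministic, given oracle access for evaluating $f$ and its gradient $\nabla f$; (ii) it returns a point $\vec{x} \in [0,1]^n$ with $f(\vec{x}) \ge \left(\tfrac{1}{2} - \epsilon\right)\max_{\vec{z} \in [0,1]^n} f(\vec{z})$; (iii) the number of rounds of adaptivity and the number of evaluations of $f$ and $\nabla f$ are $O\!\left(\frac{\log(1/\epsilon)}{\epsilon}\right)$.
   Context: A function $f:[0,1]^n \to \mathbb{R}_+$ (non-negative) is DR-submodular if for all $\vec{x} \le \vec{y}$ in $[0,1]^n$ (coordinate-wise), all $i \in [n]$ and all $\delta \in [0,1]$ such that $\vec{x}+\delta\vec{1}_{\{i\}}$ and $\vec{y}+\delta\vec{1}_{\{i\}}$ lie in $[0,1]^n$, one has $f(\vec{x}+\delta\vec{1}_{\{i\}}) - f(\vec{x}) \ge f(\vec{y}+\delta\vec{1}_{\{i\}}) - f(\vec{y})$, where $\vec{1}_{\{i\}}$ is the $i$-th standard basis vector. Throughout, $f$ is assumed differentiable (so DR-submodularity is equivalent to $\nabla f(\vec{x}) \ge \nabla f(\vec{y})$ whenever $\vec{x} \le \vec{y}$), and $f$ is extended to $\mathbb{R}^n_+$ by $f(\vec{x}) = f(\vec{x} \wedge \vec{1})$ with $(\vec{x}\wedge\vec{1})_i = \min\{x_i,1\}$. The algorithm accesses $f$ only through an oracle returning $f(\vec{z})$ and $\nabla f(\vec{z})$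 for queried points $\vec{z}$. The adaptivity of an algorithm is the number of sequential rounds of oracle queries it makes, where in each round it may issue polynomially many queries in parallel, chosen based only on answers from previous rounds. *)

theory Defs
  imports "HOL-Analysis.Analysis"
begin

(* Points of [0,1]^n are encoded as functions nat => real that vanish at
indices >= n (so that one algorithm can work uniformly for all dimensions n). *)

type_synonym point = "nat \<Rightarrow> real"
type_synonym answer = "real \<times> point"   (* (f z, grad f z) *)
type_synonym history = "(point \<times> answer) list list"  (* one list of (query, answer) per round *)

definition cube :: "nat \<Rightarrow> point set" where
  "cube n = {x. (\<forall>i<n. 0 \<le> x i \<and> x i \<le> 1) \<and> (\<forall>i\<ge>n. x i = 0)}"

definition nonneg_on_cube :: "nat \<Rightarrow> (point \<Rightarrow> real) \<Rightarrow> bool" where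
  "nonneg_on_cube n f \<longleftrightarrow> (\<forall>x\<in>cube n. 0 \<le> f x)"

definition dr_submodular :: "nat \<Rightarrow> (point \<Rightarrow> real) \<Rightarrow> bool" where
  "dr_submodular n f \<longleftrightarrow>
     (\<forall>x y i \<delta>. x \<in> cube n \<longrightarrow> y \<in> cube n \<longrightarrow> (\<forall>j. x j \<le> y j) \<longrightarrow> i < n \<longrightarrow>
        0 \<le> \<delta> \<longrightarrow> \<delta> \<le> 1 \<longrightarrow> x(i := x i + \<delta>) \<in> cube n \<longrightarrow> y(i := y i + \<delta>) \<in> cube n \<longrightarrow>
        f (x(i := x i + \<delta>)) - f x \<ge> f (y(i := y i + \<delta>)) - f y)"

definition gradient_on_cube :: "nat \<Rightarrow> (point \<Rightarrow> real) \<Rightarrow> (point \<Rightarrow> point) \<Rightarrow> bool" where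
  "gradient_on_cube n f g \<longleftrightarrow>
     (\<forall>x\<in>cube n.
        ((\<lambda>y. (f y - f x - (\<Sum>i<n. g x i * (y i - x i))) / sqrt (\<Sum>i<n. (y i - x i)\<^sup>2))
           \<longlongrightarrow> 0) (at x within cube n))"

(* Extension f(z) = f(z /\ 1): queries are truncated into the cube. *)
definition clip :: "nat \<Rightarrow> point \<Rightarrow> point" where
  "clip n z = (\<lambda>i. if i < n then max 0 (min (z i) 1) else 0)"

definition fg_answer :: "nat \<Rightarrow> (point \<Rightarrow> real) \<Rightarrow> (point \<Rightarrow> point) \<Rightarrow> point \<Rightarrow> answer" where
  "fg_answer n f g z = (f (clip n z), g (clip n z))"

(* Deterministic adaptive algorithm: in each round the (finite) list of queries
is a function of n and of the answers of previous rounds only. *)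
fun run_rounds :: "(nat \<Rightarrow> history \<Rightarrow> point list) \<Rightarrow> nat \<Rightarrow> (point \<Rightarrow> answer) \<Rightarrow> nat \<Rightarrow> history" where
  "run_rounds Q n orc 0 = []"
| "run_rounds Q n orc (Suc k) =
     (let h = run_rounds Q n orc k in h @ [map (\<lambda>z. (z, orc z)) (Q n h)])"

definition num_queries :: "history \<Rightarrow> nat" where
  "num_queries h = sum_list (map length h)"

end

theory Submission
  imports Defs
begin

text \<open>
  Double greedy with a fixed step: let s = 1/N, start from the points x and y with all coordinates
  s and 1 - s, and move them towards each other coordinatewise by s in total per round, splitting
  each step in the proportion given by the partial derivatives at x and y. For a point z let o be
  the projection of z onto the box [x, y]. The usual double greedy argument shows that
  (f(x) + f(y))/2 + f(o) never decreases, up to an error s/2 times the decrease of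
  G = sum of the coordinates of grad f(x) - grad f(y); so the errors telescope and subtracting
  s/2 * G yields a nondecreasing potential. Starting at distance s from the corners 0 and 1 makes
  f(x) + f(y) at least s * G initially, which pays for all errors at once and costs only a factor
  (1 - s)^2 in f(o). After N - 2 rounds x = y = o, whence 2 f(x) is at least (1 - 2 s) f(z).
\<close>

section \<open>Points of the cube\<close>

lemma cube_nonneg: "x \<in> cube n \<Longrightarrow> 0 \<le> x i"
  by (cases "i < n") (auto simp: cube_def)

lemma cube_le_1: "x \<in> cube n \<Longrightarrow> x i \<le> 1"
  by (cases "i < n") (auto simp: cube_def)

lemma cube_outside: "x \<in> cube n \<Longrightarrow> n \<le> i \<Longrightarrow> x i = 0"
  by (auto simp: cube_def)

lemma clip_cube: "x \<in> cube n \<Longrightarrow> clip n x = x"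
  by (rule ext) (auto simp: clip_def cube_def)

lemma cube_line:
  assumes "x \<in> cube n" "y \<in> cube n" "0 \<le> t" "t \<le> 1"
  shows "(\<lambda>i. x i + t * (y i - x i)) \<in> cube n"
proof -
  have "0 \<le> x i + t * (y i - x i) \<and> x i + t * (y i - x i) \<le> 1" for i
    using assms cube_nonneg[OF assms(1), of i] cube_nonneg[OF assms(2), of i]
      cube_le_1[OF assms(1), of i] cube_le_1[OF assms(2), of i]
      convex_bound_le[of "x i" 1 "y i" "1 - t" t]
      add_nonneg_nonneg[of "(1 - t) * x i" "t * y i"] mult_nonneg_nonneg[of "1 - t" "x i"]
    by (simp add: algebra_simps)
  with assms show ?thesis
    by (auto simp: cube_def)
qed

lemma cube_fun_upd: "x \<in> cube n \<Longrightarrow> i < n \<Longrightarrow> 0 \<le> t \<Longrightarrow> t \<le> 1 \<Longrightarrow> x(i := t) \<in> cube n"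
  by (auto simp: cube_def)

section \<open>Splitting the step in one coordinate\<close>

text \<open>The double greedy ratio \<open>max a 0 / (max a 0 + max (- b) 0)\<close>, with 0/0 read
  as 1. Here \<open>a\<close> and \<open>b\<close> are the partial derivatives at the lower and the
  upper point, and the ratio is the part of the step by which the lower point rises.\<close>

definition share :: "real \<Rightarrow> real \<Rightarrow> real" where
  "share a b = (if 0 \<le> b then 1 else if a \<le> 0 then 0 else a / (a - b))"

lemma share_bounds: "0 \<le> share a b" "share a b \<le> 1"
  by (auto simp: share_def field_simps)

text \<open>
  For a > 0 > b and p = a / (a - b), both possible losses are at most s * a * (-b) / (a - b),
  while the gain is s/2 * (a^2 + b^2) / (a - b).
\<close>

lemma share_gain:
  assumes "b \<le> a" "0 \<le> s" "- s * (1 - share a b) \<le> d" "d \<le> s * share a b"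
  shows "0 \<le> (s * share a b * a - s * (1 - share a b) * b) / 2 + b * max d 0 + a * min d 0"
proof -
  consider "0 \<le> b" | "b < 0" "a \<le> 0" | "b < 0" "0 < a"
    by linarith
  then show ?thesis
  proof cases
    case 1
    with assms show ?thesis
      by (auto simp: share_def)
  next
    case 2
    with assms have d: "- s \<le> d" "d \<le> 0"
      by (auto simp: share_def)
    have "0 \<le> a * d" "0 \<le> s * - b"
      using 2 assms d by (auto simp: mult_nonpos_nonpos intro: mult_nonneg_nonpos)
    with 2 d show ?thesis
      by (auto simp: share_def min_def max_def)
  next
    case 3
    define p where "p = a / (a - b)"
    have p: "share a b = p"
      using 3 by (simp add: share_def p_def)
    have q: "1 - p = - b / (a - b)"
      using 3 by (simp add: p_def field_simps)
    have ab: "p * a - (1 - p) * b = (a\<^sup>2 + b\<^sup>2) / (a - b)" "p * b = a * b / (a - b)"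
       "(1 - p) * a = - (a * b / (a - b))"
      unfolding q by (simp_all add: p_def power2_eq_square add_divide_distrib mult.commute)
    have "0 \<le> (a + b)\<^sup>2 / (a - b)"
      using 3 by simp
    also have "\<dots> = (p * a - (1 - p) * b) + 2 * (a * b / (a - b))"
      unfolding ab by (simp add: power2_sum add_divide_distrib)
    finally have gain: "- (a * b / (a - b)) \<le> (p * a - (1 - p) * b) / 2"
      by simp
    have "b * max d 0 + a * min d 0 \<ge> s * (a * b / (a - b))"
    proof (cases "0 \<le> d")
      case True
      then have "b * max d 0 + a * min d 0 = b * d"
        by simp
      also have "\<dots> \<ge> b * (s * p)"
        using assms(4) 3 p by (intro mult_left_mono_neg) auto
      finally show ?thesis
        unfolding ab(2)[symmetric] by (simp add: mult_ac)
    next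
      case False
      then have "b * max d 0 + a * min d 0 = a * d"
        by simp
      also have "\<dots> \<ge> a * (- s * (1 - p))"
        using assms(3) 3 p by (intro mult_left_mono) auto
      also have "a * (- s * (1 - p)) = s * (a * b / (a - b))"
        using arg_cong[OF ab(3), of "(*) s"] by (simp add: mult_ac)
      finally show ?thesis .
    qed
    moreover have "s * (- (a * b / (a - b))) \<le> s * ((p * a - (1 - p) * b) / 2)"
      using gain assms(2) by (rule mult_left_mono)
    moreover have "s * ((p * a - (1 - p) * b) / 2) = (s * p * a - s * (1 - p) * b) / 2"
      by (simp add: algebra_simps)
    ultimately show ?thesis
      unfolding p mult_minus_right by linarith
  qed
qed

section \<open>A fact of one-variable calculus\<close>

text \<open>All difference quotients of a monotone function are nonnegative. The derivative is taken
  within the interval because gradients on the boundary of the cube lead to endpoints.\<close>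

lemma monotone_derivative_nonneg:
  fixes F :: "real \<Rightarrow> real"
  assumes "(F has_real_derivative D) (at x within {a..b})" "a < b" "a \<le> x" "x \<le> b"
    and mono: "\<And>s t. a \<le> s \<Longrightarrow> s \<le> t \<Longrightarrow> t \<le> b \<Longrightarrow> F s \<le> F t"
  shows "0 \<le> D"
proof (rule tendsto_lowerbound)
  show "((\<lambda>y. (F y - F x) / (y - x)) \<longlongrightarrow> D) (at x within {a..b})"
    using assms(1) by (simp add: has_field_derivative_iff)
  have "0 \<le> (F y - F x) / (y - x)" if "y \<in> {a..b}" for y
    using that assms(3,4) mono[of x y] mono[of y x]
    by (cases "x \<le> y") (auto intro: divide_nonneg_nonneg divide_nonpos_nonpos)
  then show "\<forall>\<^sub>F y in at x within {a..b}. 0 \<le> (F y - F x) / (y - x)"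
    by (auto simp: eventually_at_filter)
  show "at x within {a..b} \<noteq> bot"
    using assms by (simp add: trivial_limit_within islimpt_Icc)
qed

section \<open>The algorithm\<close>

definition diag :: "nat \<Rightarrow> real \<Rightarrow> point" where
  "diag n c = (\<lambda>i. if i < n then c else 0)"

definition project :: "point \<Rightarrow> point \<Rightarrow> point \<Rightarrow> point" where
  "project z x y = (\<lambda>i. min (max (z i) (x i)) (y i))"

definition dg_step :: "nat \<Rightarrow> real \<Rightarrow> point \<Rightarrow> point \<Rightarrow> point \<Rightarrow> point \<Rightarrow> point \<times> point" where
  "dg_step n s x y a b =
     ((\<lambda>i. if i < n then x i + s * share (a i) (b i) else 0),
      (\<lambda>i. if i < n then y i - s * (1 - share (a i) (b i)) else 0))"

text \<open>The state is not stored but recovered: the queries of a round are the two current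
  points, so the last round alone yields both points and their gradients. Hence the state after the
  final round costs no further query.\<close>

definition dg_state :: "real \<Rightarrow> nat \<Rightarrow> history \<Rightarrow> point \<times> point" where
  "dg_state s n h =
     (if h = [] then (diag n s, diag n (1 - s))
      else let (x, _, a) = last h ! 0; (y, _, b) = last h ! 1 in dg_step n s x y a b)"

definition dg_queries :: "real \<Rightarrow> nat \<Rightarrow> history \<Rightarrow> point list" where
  "dg_queries s n h = [fst (dg_state s n h), snd (dg_state s n h)]"

lemma num_queries_dg: "num_queries (run_rounds (dg_queries s) n orc k) = 2 * k"
  by (induction k) (simp_all add: num_queries_def Let_def dg_queries_def)

text \<open>For points of the cube the clipping in \<open>fg_answer\<close> is the identity, so the
  recorded gradients are those at the state itself.\<close>

lemma dg_state_Suc: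
  assumes "dg_state s n (run_rounds (dg_queries s) n (fg_answer n f g) k) = (x, y)"
    and "x \<in> cube n" "y \<in> cube n"
  shows "dg_state s n (run_rounds (dg_queries s) n (fg_answer n f g) (Suc k))
    = dg_step n s x y (g x) (g y)"
  using assms by (simp add: dg_state_def[of s n "_ @ _"] Let_def dg_queries_def fg_answer_def clip_cube)

lemma diag_cube: "0 \<le> c \<Longrightarrow> c \<le> 1 \<Longrightarrow> diag n c \<in> cube n"
  by (simp add: diag_def cube_def)

lemma project_cube:
  assumes "x \<in> cube n" "y \<in> cube n" "z \<in> cube n"
  shows "project z x y \<in> cube n"
  using assms by (auto simp: cube_def project_def min_def max_def)

section \<open>Derivatives and gradients of a DR-submodular function\<close>

locale dr_instance =
  fixes n :: nat and f :: "point \<Rightarrow> real" and g :: "point \<Rightarrow> point"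
  assumes nonneg: "nonneg_on_cube n f"
    and dr: "dr_submodular n f"
    and gradient: "gradient_on_cube n f g"
begin

lemma f_nonneg: "x \<in> cube n \<Longrightarrow> 0 \<le> f x"
  using nonneg by (auto simp: nonneg_on_cube_def)

text \<open>A chain rule: the limit that defines the gradient is composed with the segment from
  \<open>x\<close> to \<open>y\<close>, which is continuous and, for distinct endpoints,
  injective.\<close>

lemma line_has_derivative:
  assumes x: "x \<in> cube n" and y: "y \<in> cube n" and t: "0 \<le> t" "t \<le> 1"
  defines "l \<equiv> \<lambda>t i. x i + t * (y i - x i)"
  shows "((\<lambda>t. f (l t)) has_real_derivative (\<Sum>i<n. g (l t) i * (y i - x i)))
           (at t within {0..1})"
proof (cases "x = y")
  case True
  then show ?thesis
    by (simp add: l_def)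
next
  case False
  define c where "c = sqrt (\<Sum>i<n. (y i - x i)\<^sup>2)"
  define D where "D = (\<Sum>i<n. g (l t) i * (y i - x i))"
  define q where "q = (\<lambda>w. (f w - f (l t) - (\<Sum>i<n. g (l t) i * (w i - l t i)))
                         / sqrt (\<Sum>i<n. (w i - l t i)\<^sup>2))"
  from False obtain j where j: "x j \<noteq> y j"
    by blast
  with x y have "j < n"
    by (metis cube_outside not_le)
  with j have "0 < (\<Sum>i<n. (y i - x i)\<^sup>2)"
    by (intro sum_pos2[of _ j]) auto
  then have c: "0 < c"
    by (simp add: c_def)
  have lt: "l s \<in> cube n" if "0 \<le> s" "s \<le> 1" for s
    using cube_line[OF x y that] by (simp add: l_def)
  \<comment> \<open>Points carry the product topology, so continuity is checked
    coordinatewise.\<close>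
  have "isCont l t"
    unfolding l_def
    by (intro continuous_on_interior[of UNIV] continuous_on_coordinatewise_then_product
        continuous_intros) auto
  then have "(l \<longlongrightarrow> l t) (at t within {0..1})"
    using continuous_at_imp_continuous_at_within continuous_within by blast
  moreover have "l s \<noteq> l t" if "s \<noteq> t" for s
    using that j by (auto simp: l_def fun_eq_iff intro!: exI[of _ j])
  ultimately have "filterlim l (at (l t) within cube n) (at t within {0..1})"
    unfolding filterlim_at using lt by (auto simp: eventually_at_filter)
  moreover have "(q \<longlongrightarrow> 0) (at (l t) within cube n)"
    using gradient lt t unfolding gradient_on_cube_def q_def by blast
  ultimately have "((\<lambda>s. q (l s)) \<longlongrightarrow> 0) (at t within {0..1})"
    by (rule filterlim_compose[rotated])
  then have lim: "((\<lambda>s. c * \<bar>q (l s)\<bar>) \<longlongrightarrow> 0) (at t within {0..1})"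
    using tendsto_mult_right_zero tendsto_rabs_zero by blast
  \<comment> \<open>The remainder quotient \<open>q\<close> divides by the distance |s - t| * c, the
    difference quotient by s - t; they agree up to the factor c and a sign, which the absolute
    values remove.\<close>
  have "\<bar>(f (l s) - f (l t)) / (s - t) - D\<bar> = c * \<bar>q (l s)\<bar>" if "s \<noteq> t" for s
  proof -
    have diff: "l s i - l t i = (s - t) * (y i - x i)" for i
      by (simp add: l_def algebra_simps)
    have "(\<Sum>i<n. (l s i - l t i)\<^sup>2) = (s - t)\<^sup>2 * (\<Sum>i<n. (y i - x i)\<^sup>2)"
      by (simp add: diff power_mult_distrib sum_distrib_left)
    then have "sqrt (\<Sum>i<n. (l s i - l t i)\<^sup>2) = \<bar>s - t\<bar> * c"
      by (simp add: c_def real_sqrt_mult)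
    moreover have "(\<Sum>i<n. g (l t) i * (l s i - l t i)) = (s - t) * D"
      by (simp add: diff D_def sum_distrib_left mult_ac)
    ultimately have "q (l s) = (f (l s) - f (l t) - (s - t) * D) / (\<bar>s - t\<bar> * c)"
      by (simp add: q_def)
    moreover have "(f (l s) - f (l t)) / (s - t) - D = (f (l s) - f (l t) - (s - t) * D) / (s - t)"
      using that by (simp add: field_simps)
    ultimately show ?thesis
      using c that by (simp add: abs_mult)
  qed
  then have "\<forall>\<^sub>F s in at t within {0..1}. c * \<bar>q (l s)\<bar> = \<bar>(f (l s) - f (l t)) / (s - t) - D\<bar>"
    by (auto simp: eventually_at_filter)
  from Lim_transform_eventually[OF lim this]
  have "((\<lambda>s. (f (l s) - f (l t)) / (s - t) - D) \<longlongrightarrow> 0) (at t within {0..1})"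
    by (simp add: tendsto_rabs_zero_iff)
  then show ?thesis
    unfolding has_field_derivative_iff D_def[symmetric] by (simp add: LIM_zero_iff)
qed

lemma coordinate_has_derivative:
  assumes x: "x \<in> cube n" and i: "i < n" and t: "0 \<le> t" "t \<le> 1"
  shows "((\<lambda>t. f (x(i := t))) has_real_derivative g (x(i := t)) i) (at t within {0..1})"
proof -
  have line: "(\<lambda>j. (x(i := 0)) j + s * ((x(i := 1)) j - (x(i := 0)) j)) = x(i := s)" for s
    by auto
  have "(\<Sum>j<n. g (x(i := t)) j * ((x(i := 1)) j - (x(i := 0)) j))
      = (\<Sum>j<n. if j = i then g (x(i := t)) i else 0)"
    by (intro sum.cong) auto
  then have "(\<Sum>j<n. g (x(i := t)) j * ((x(i := 1)) j - (x(i := 0)) j)) = g (x(i := t)) i"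
    using i by simp
  with line_has_derivative[of "x(i := 0)" "x(i := 1)" t] x i t show ?thesis
    unfolding line by (simp add: cube_fun_upd)
qed

lemma increment_antimono:
  assumes "x \<in> cube n" "y \<in> cube n" "\<And>j. x j \<le> y j" "i < n" "0 \<le> \<delta>"
    "x i + \<delta> \<le> 1" "y i + \<delta> \<le> 1"
  shows "f (y(i := y i + \<delta>)) - f y \<le> f (x(i := x i + \<delta>)) - f x"
proof -
  have "x(i := x i + \<delta>) \<in> cube n" "y(i := y i + \<delta>) \<in> cube n" "\<delta> \<le> 1"
    using assms cube_nonneg[of x n i] cube_nonneg[of y n i] by (auto intro!: cube_fun_upd)
  with assms dr show ?thesis
    unfolding dr_submodular_def by blast
qed


text \<open>Shift the parameter so that both coordinate lines are run through together: by the DR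
  property, the difference \<open>F\<close> of the two restrictions is monotone, and its derivative
  is the difference of the partial derivatives.\<close>

lemma gradient_antimono:
  assumes x: "x \<in> cube n" and y: "y \<in> cube n" and le: "\<And>j. x j \<le> y j" and i: "i < n"
  shows "g y i \<le> g x i"
proof -
  \<comment> \<open>The common parameter interval is {0..1 - c}, where c is the distance of the
    points in coordinate \<open>i\<close>; it has positive length only for c < 1.\<close>
  have *: "g v i \<le> g u i"
    if uv: "u \<in> cube n" "v \<in> cube n" "\<And>j. u j \<le> v j" and c: "v i - u i < 1" for u v
  proof -
    define c where "c = v i - u i"
    define F where "F = (\<lambda>t. f (u(i := t)) - f (v(i := t + c)))"
    have u: "0 \<le> u i" "u i \<le> 1 - c" "0 \<le> c" "c < 1"
      using uv c cube_nonneg[of u n i] cube_le_1[of v n i] by (auto simp: c_def)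
    have "((\<lambda>t. f (u(i := t))) has_real_derivative g (u(i := u i)) i) (at (u i) within {0..1 - c})"
      using coordinate_has_derivative[of u i "u i"] u uv i
      by (auto intro: has_field_derivative_subset)
    moreover have "(((\<lambda>t. f (v(i := t))) \<circ> (\<lambda>t. t + c)) has_real_derivative g (v(i := u i + c)) i * 1)
        (at (u i) within {0..1 - c})"
    proof (rule DERIV_image_chain)
      show "((\<lambda>t. f (v(i := t))) has_real_derivative g (v(i := u i + c)) i)
          (at (u i + c) within (\<lambda>t. t + c) ` {0..1 - c})"
        using coordinate_has_derivative[of v i "u i + c"] u uv i
        by (auto intro: has_field_derivative_subset)
    qed (auto intro!: derivative_eq_intros)
    ultimately have "(F has_real_derivative g u i - g v i) (at (u i) within {0..1 - c})"
      unfolding F_def by (auto intro!: derivative_eq_intros simp: o_def c_def)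
    moreover have "F s \<le> F t" if "0 \<le> s" "s \<le> t" "t \<le> 1 - c" for s t
      using increment_antimono[of "u(i := s)" "v(i := s + c)" i "t - s"] that u uv i
      by (simp add: F_def cube_fun_upd algebra_simps)
    ultimately have "0 \<le> g u i - g v i"
      using monotone_derivative_nonneg[of F "g u i - g v i" "u i" 0 "1 - c"] u by force
    then show ?thesis
      by simp
  qed
  show ?thesis
  proof (cases "y i - x i < 1")
    case True
    with * x y le show ?thesis
      by blast
  next
    case False
    with cube_nonneg[OF x, of i] cube_le_1[OF y, of i] have xy: "x i = 0" "y i = 1"
      by auto
    \<comment> \<open>At distance 1 the comparison is made in two steps of length 1/2.\<close>
    have "x(i := 1/2) \<in> cube n"
      using x i by (simp add: cube_fun_upd)
    with xy have "g (x(i := 1/2)) i \<le> g x i" "g y i \<le> g (x(i := 1/2)) i"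
      using x y le by (auto intro!: *)
    then show ?thesis
      by simp
  qed
qed

text \<open>The mean value theorem gives a gradient at a point between \<open>x\<close> and
  \<open>y\<close>, and antitonicity compares it with the gradients at the ends.\<close>

lemma gradient_bounds:
  assumes x: "x \<in> cube n" and y: "y \<in> cube n" and le: "\<And>j. x j \<le> y j"
  shows "(\<Sum>i<n. g y i * (y i - x i)) \<le> f y - f x"
    and "f y - f x \<le> (\<Sum>i<n. g x i * (y i - x i))"
proof -
  define l where "l = (\<lambda>t i. x i + t * (y i - x i))"
  have "\<exists>t\<in>{0<..<1}. f (l 1) - f (l 0) = (\<Sum>i<n. g (l t) i * (y i - x i)) * (1 - 0)"
    using line_has_derivative[OF x y] unfolding l_def has_field_derivative_def
    by (intro mvt_simple) auto
  then obtain t where t: "0 < t" "t < 1" and eq: "f y - f x = (\<Sum>i<n. g (l t) i * (y i - x i))"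
    by (auto simp: l_def)
  have lt: "l t \<in> cube n"
    unfolding l_def using x y t by (intro cube_line) auto
  have "x j \<le> l t j" "l t j \<le> y j" for j
    using le[of j] t mult_left_le_one_le[of "y j - x j" t] by (auto simp: l_def)
  with x y le lt show "(\<Sum>i<n. g y i * (y i - x i)) \<le> f y - f x"
    and "f y - f x \<le> (\<Sum>i<n. g x i * (y i - x i))"
    unfolding eq by (auto intro!: sum_mono mult_right_mono gradient_antimono)
qed

section \<open>Concavity along nonnegative directions\<close>

text \<open>The slope \<open>S\<close> at the intermediate point bounds the increment before it from
  below and the one after it from above; weighting the two bounds by 1 - t and t cancels
  \<open>S\<close>.\<close>

lemma concave_on_increasing_line:
  assumes x: "x \<in> cube n" and y: "y \<in> cube n" and le: "\<And>j. x j \<le> y j" and t: "0 \<le> t" "t \<le> 1"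
  shows "(1 - t) * f x + t * f y \<le> f (\<lambda>i. x i + t * (y i - x i))"
proof -
  define m where "m = (\<lambda>i. x i + t * (y i - x i))"
  define S where "S = (\<Sum>i<n. g m i * (y i - x i))"
  have m: "m \<in> cube n"
    unfolding m_def using x y t by (rule cube_line)
  have le': "x j \<le> m j" "m j \<le> y j" for j
    using le[of j] t mult_left_le_one_le[of "y j - x j" t] by (auto simp: m_def)
  have "(\<Sum>i<n. g m i * (m i - x i)) = t * S"
    by (simp add: S_def m_def sum_distrib_left mult_ac)
  then have "t * S \<le> f m - f x"
    using gradient_bounds(1)[OF x m] le' by simp
  then have 1: "(1 - t) * (t * S) \<le> (1 - t) * (f m - f x)"
    using t by (intro mult_left_mono) auto
  have "y i - m i = (1 - t) * (y i - x i)" for i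
    by (simp add: m_def algebra_simps)
  then have "(\<Sum>i<n. g m i * (y i - m i)) = (1 - t) * S"
    by (simp add: S_def sum_distrib_left mult_ac)
  then have "f y - f m \<le> (1 - t) * S"
    using gradient_bounds(2)[OF m y] le' by simp
  then have 2: "t * (f y - f m) \<le> t * ((1 - t) * S)"
    using t by (intro mult_left_mono) auto
  from 1 2 show ?thesis
    unfolding m_def[symmetric] by (simp add: algebra_simps)
qed

text \<open>The displacement from \<open>z\<close> to the raised point can be stretched by 1/s
  without leaving the cube. The raised point thus lies at fraction \<open>s\<close> of a segment
  from \<open>z\<close> to \<open>w\<close>, where concavity and nonnegativity of f at
  \<open>w\<close> apply.\<close>

lemma f_raise:
  assumes z: "z \<in> cube n" and s: "0 < s" "s \<le> 1"
  shows "(1 - s) * f z \<le> f (\<lambda>i. max (z i) (diag n s i))"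
proof -
  define w where "w = (\<lambda>i. z i + max 0 (diag n s i - z i) / s)"
  have "max 0 (s - z i) / s \<le> 1 - z i" for i
    using s cube_nonneg[OF z, of i] cube_le_1[OF z, of i] mult_right_mono[of s 1 "z i"]
    by (auto simp: max_def field_simps)
  then have "w i \<le> 1" if "i < n" for i
    using that by (simp add: w_def diag_def algebra_simps)
  moreover have "z i \<le> w i" for i
    using s by (simp add: w_def)
  moreover have "w i = 0" if "n \<le> i" for i
    using that cube_outside[OF z that] by (simp add: w_def diag_def)
  ultimately have w: "w \<in> cube n" "\<And>i. z i \<le> w i"
    unfolding cube_def by (auto intro: order_trans[OF cube_nonneg[OF z]])
  have "(\<lambda>i. z i + s * (w i - z i)) = (\<lambda>i. max (z i) (diag n s i))"
    using s by (auto simp: w_def max_def)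
  with concave_on_increasing_line[OF z w(1) w(2), of s] s mult_nonneg_nonneg[OF _ f_nonneg[OF w(1)], of s]
  show ?thesis
    by simp
qed

text \<open>Mirror image of \<open>f_raise\<close>: \<open>w\<close> overshoots downwards, and the
  lowered point lies at fraction 1 - s of the way from \<open>w\<close> up to
  \<open>z\<close>.\<close>

lemma f_lower:
  assumes z: "z \<in> cube n" and s: "0 < s" "s \<le> 1"
  shows "(1 - s) * f z \<le> f (\<lambda>i. min (z i) (diag n (1 - s) i))"
proof -
  define w where "w = (\<lambda>i. z i - max 0 (z i - diag n (1 - s) i) / s)"
  have "max 0 (z i - (1 - s)) / s \<le> z i" for i
    using s cube_nonneg[OF z, of i] cube_le_1[OF z, of i] mult_left_mono[of "z i" 1 "1 - s"]
    by (auto simp: max_def field_simps)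
  then have "0 \<le> w i" if "i < n" for i
    using that by (simp add: w_def diag_def)
  moreover have "w i \<le> z i" for i
    using s by (simp add: w_def)
  moreover have "w i = 0" if "n \<le> i" for i
    using that cube_outside[OF z that] by (simp add: w_def diag_def)
  ultimately have w: "w \<in> cube n" "\<And>i. w i \<le> z i"
    unfolding cube_def by (auto intro: order_trans[OF _ cube_le_1[OF z]])
  have "(\<lambda>i. w i + (1 - s) * (z i - w i)) = (\<lambda>i. min (z i) (diag n (1 - s) i))"
    using s by (auto simp: w_def max_def min_def field_simps)
  with concave_on_increasing_line[OF w(1) z w(2), of "1 - s"] s mult_nonneg_nonneg[OF _ f_nonneg[OF w(1)], of s]
  show ?thesis
    by simp
qed

lemma f_project_diag:
  assumes z: "z \<in> cube n" and s: "0 < s" "s \<le> 1/2"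
  shows "(1 - 2 * s) * f z \<le> f (project z (diag n s) (diag n (1 - s)))"
proof -
  let ?m = "\<lambda>i. max (z i) (diag n s i)"
  have "?m \<in> cube n"
    using z s by (auto simp: cube_def diag_def)
  with s have "(1 - s) * f ?m \<le> f (project z (diag n s) (diag n (1 - s)))"
    unfolding project_def by (intro f_lower) auto
  moreover have "(1 - s) * ((1 - s) * f z) \<le> (1 - s) * f ?m"
    using z s by (intro mult_left_mono f_raise) auto
  moreover have "(1 - 2 * s) * f z \<le> (1 - s) * ((1 - s) * f z)"
    using f_nonneg[OF z] mult_nonneg_nonneg[of "s * s" "f z"] by (simp add: algebra_simps)
  ultimately show ?thesis
    by simp
qed

section \<open>The potential and its growth in one round\<close>

definition potential :: "real \<Rightarrow> point \<Rightarrow> point \<Rightarrow> point \<Rightarrow> real" where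
  "potential s z x y = (f x + f y) / 2 + f (project z x y) - s / 2 * (\<Sum>i<n. g x i - g y i)"

lemma dg_step:
  assumes x: "x \<in> cube n" and y: "y \<in> cube n" and z: "z \<in> cube n"
    and s: "0 \<le> s" and gap: "\<And>i. i < n \<Longrightarrow> s \<le> y i - x i"
    and step: "dg_step n s x y (g x) (g y) = (x', y')"
  shows "x' \<in> cube n" "y' \<in> cube n"
    and "\<And>i. i < n \<Longrightarrow> y' i - x' i = y i - x i - s"
    and "potential s z x y \<le> potential s z x' y'"
proof -
  define p where "p = (\<lambda>i. share (g x i) (g y i))"
  have x': "x' = (\<lambda>i. if i < n then x i + s * p i else 0)"
    and y': "y' = (\<lambda>i. if i < n then y i - s * (1 - p i) else 0)"
    using step by (auto simp: dg_step_def p_def)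
  have p: "0 \<le> p i" "p i \<le> 1" for i
    by (auto simp: p_def share_bounds)
  have sp: "0 \<le> s * p i" "0 \<le> s * (1 - p i)" "s * p i + s * (1 - p i) = s" for i
    using s p[of i] by (auto simp: algebra_simps mult_left_le)
  have in_xy: "x i \<le> x' i \<and> x' i \<le> y' i \<and> y' i \<le> y i" for i
    using gap[of i] sp[of i] cube_outside[OF x, of i] cube_outside[OF y, of i]
    by (auto simp: x' y')
  have "0 \<le> x' i" "x' i \<le> 1" "0 \<le> y' i" "y' i \<le> 1" for i
    using in_xy[of i] cube_nonneg[OF x, of i] cube_le_1[OF y, of i] by auto
  then show x'_cube: "x' \<in> cube n" and y'_cube: "y' \<in> cube n"
    unfolding cube_def by simp_all (simp_all add: x' y')
  show "y' i - x' i = y i - x i - s" if "i < n" for i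
    using that sp[of i] by (simp add: x' y')

  define u where "u = project z x y"
  define u' where "u' = project z x' y'"
  \<comment> \<open>Gradient bounds need comparable points, so the move from \<open>u\<close> to
    \<open>u'\<close> goes through their join: first all coordinates that rise, then all that
    fall.\<close>
  define m where "m = (\<lambda>i. max (u i) (u' i))"
  define d where "d = (\<lambda>i. u' i - u i)"
  have u: "u \<in> cube n" and u': "u' \<in> cube n"
    using x y z x'_cube y'_cube by (auto simp: u_def u'_def project_cube)
  then have m: "m \<in> cube n"
    by (auto simp: m_def cube_def max_def)
  have m_y: "m i \<le> y i" and u'_x: "x i \<le> u' i" for i
    using in_xy[of i] by (auto simp: m_def u_def u'_def project_def)
  \<comment> \<open>The projection rises by at most the rise of the lower end of the box and falls
    by at most the fall of the upper end.\<close>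
  have d: "- s * (1 - p i) \<le> d i \<and> d i \<le> s * p i" if "i < n" for i
  proof -
    have "x' i - x i = s * p i" "y i - y' i = s * (1 - p i)"
      using that by (auto simp: x' y')
    with in_xy[of i] show ?thesis
      unfolding d_def u_def u'_def project_def mult_minus_left by linarith
  qed

  \<comment> \<open>The upward part stays below \<open>y\<close> and is charged to the gradient at
    \<open>y\<close>; the downward part stays above \<open>x\<close> and is charged to the gradient
    at \<open>x\<close>.\<close>
  have "(\<Sum>i<n. g y i * max (d i) 0) \<le> (\<Sum>i<n. g m i * (m i - u i))"
    using m y m_y
    by (auto intro!: sum_mono mult_right_mono gradient_antimono simp: m_def d_def max_def)
  also have "\<dots> \<le> f m - f u"
    using u m by (intro gradient_bounds) (auto simp: m_def)
  finally have up: "(\<Sum>i<n. g y i * max (d i) 0) \<le> f m - f u" .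
  have "f m - f u' \<le> (\<Sum>i<n. g u' i * (m i - u' i))"
    using u' m by (intro gradient_bounds) (auto simp: m_def)
  also have "\<dots> \<le> (\<Sum>i<n. g x i * (m i - u' i))"
    using u' x u'_x by (intro sum_mono mult_right_mono gradient_antimono) (auto simp: m_def)
  also have "\<dots> = - (\<Sum>i<n. g x i * min (d i) 0)"
    unfolding sum_negf[symmetric] by (intro sum.cong) (auto simp: m_def d_def max_def min_def algebra_simps)
  finally have down: "(\<Sum>i<n. g x i * min (d i) 0) \<le> f u' - f m"
    by simp
  \<comment> \<open>The guaranteed gains involve the gradients at the new points, whereas the step
    was chosen from the old ones.\<close>
  have gain_x: "(\<Sum>i<n. g x' i * (s * p i)) \<le> f x' - f x"
    using gradient_bounds(1)[OF x x'_cube] in_xy by (simp add: x')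
  have gain_y: "(\<Sum>i<n. - g y' i * (s * (1 - p i))) \<le> f y' - f y"
    using gradient_bounds(2)[OF y'_cube y] in_xy by (simp add: y' sum_negf)

  \<comment> \<open>Passing from new to old gradients costs the two nonnegative gradient drops with
    weights p and 1 - p. As both weights are at most 1, half of s times the drop of the gradient
    difference covers this cost.\<close>
  have loss: "(s * p i * g x i - s * (1 - p i) * g y i) / 2
      - s / 2 * ((g x i - g y i) - (g x' i - g y' i))
      \<le> (g x' i * (s * p i) + - g y' i * (s * (1 - p i))) / 2" if "i < n" for i
  proof -
    have "0 \<le> s * (1 - p i) * (g x i - g x' i)" "0 \<le> s * p i * (g y' i - g y i)"
      using sp gradient_antimono[OF x x'_cube _ that] gradient_antimono[OF y'_cube y _ that] in_xy
      by (auto intro!: mult_nonneg_nonneg)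
    then show ?thesis
      by (simp add: field_simps)
  qed
  have gain: "0 \<le> (s * p i * g x i - s * (1 - p i) * g y i) / 2
      + g y i * max (d i) 0 + g x i * min (d i) 0" if "i < n" for i
    unfolding p_def
  proof (rule share_gain)
    show "g y i \<le> g x i"
      using x y that in_xy by (intro gradient_antimono) (auto intro: order_trans)
  qed (use s d that in \<open>auto simp: p_def\<close>)
  have "0 \<le> (g x' i * (s * p i) + - g y' i * (s * (1 - p i))) / 2
      + g y i * max (d i) 0 + g x i * min (d i) 0
      + s / 2 * ((g x i - g y i) - (g x' i - g y' i))" if "i < n" for i
    using loss[OF that] gain[OF that] by linarith
  then have "0 \<le> (\<Sum>i<n. (g x' i * (s * p i) + - g y' i * (s * (1 - p i))) / 2
      + g y i * max (d i) 0 + g x i * min (d i) 0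
      + s / 2 * ((g x i - g y i) - (g x' i - g y' i)))"
    by (intro sum_nonneg) auto
  also have "\<dots> = ((\<Sum>i<n. g x' i * (s * p i)) + (\<Sum>i<n. - g y' i * (s * (1 - p i)))) / 2
      + (\<Sum>i<n. g y i * max (d i) 0) + (\<Sum>i<n. g x i * min (d i) 0)
      + s / 2 * ((\<Sum>i<n. g x i - g y i) - (\<Sum>i<n. g x' i - g y' i))"
    by (simp only: sum.distrib sum_subtractf sum_distrib_left[symmetric] sum_divide_distrib[symmetric])
  also have "\<dots> \<le> ((f x' - f x) + (f y' - f y)) / 2 + (f m - f u) + (f u' - f m)
      + s / 2 * ((\<Sum>i<n. g x i - g y i) - (\<Sum>i<n. g x' i - g y' i))"
    using up down gain_x gain_y by (intro add_mono divide_right_mono) auto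
  also have "\<dots> = potential s z x' y' - potential s z x y"
    by (simp add: potential_def u_def u'_def field_simps)
  finally show "potential s z x y \<le> potential s z x' y'"
    by simp
qed

section \<open>The potential over the whole run\<close>

lemma potential_start:
  assumes z: "z \<in> cube n" and s: "0 < s" "s \<le> 1/2"
  shows "(1 - 2 * s) * f z \<le> potential s z (diag n s) (diag n (1 - s))"
proof -
  let ?x = "diag n s" and ?y = "diag n (1 - s)"
  have c: "?x \<in> cube n" "?y \<in> cube n" "diag n 0 \<in> cube n" "diag n 1 \<in> cube n"
    using s by (auto intro: diag_cube)
  have "(\<Sum>i<n. g ?x i * s) \<le> f ?x - f (diag n 0)"
    using gradient_bounds(1)[OF c(3,1)] s by (simp add: diag_def)
  moreover have "f (diag n 1) - f ?y \<le> (\<Sum>i<n. g ?y i * s)"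
    using gradient_bounds(2)[OF c(2,4)] s by (simp add: diag_def)
  \<comment> \<open>The values at the corners 0 and 1 are dropped by nonnegativity.\<close>
  ultimately have "s * (\<Sum>i<n. g ?x i - g ?y i) \<le> f ?x + f ?y"
    using c[THEN f_nonneg] unfolding sum_subtractf sum_distrib_right[symmetric] right_diff_distrib
    by (simp add: mult.commute)
  with f_project_diag[OF assms] show ?thesis
    by (simp add: potential_def field_simps)
qed

text \<open>The 2 in \<open>real k + 2\<close> accounts for the margins 1/N left at both ends by the
  start. The next round needs a gap of at least 1/N, which is what the bound on \<open>k\<close>
  ensures.\<close>

lemma dg_invariant:
  assumes z: "z \<in> cube n" and N: "2 \<le> N" and k: "k + 2 \<le> N"
    and st: "dg_state (1 / real N) n
      (run_rounds (dg_queries (1 / real N)) n (fg_answer n f g) k) = (x, y)"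
  shows "x \<in> cube n \<and> y \<in> cube n \<and> (\<forall>i<n. y i - x i = 1 - (real k + 2) / real N) \<and>
    (1 - 2 / real N) * f z \<le> potential (1 / real N) z x y"
  using k st
proof (induction k arbitrary: x y)
  case 0
  have "1 / real N \<le> 1 / 2"
    using N by (intro divide_left_mono) auto
  with 0 N potential_start[OF z, of "1 / real N"] show ?case
    by (auto simp: dg_state_def diag_def[abs_def] cube_def field_simps)
next
  case (Suc k)
  let ?s = "1 / real N"
  obtain v w where vw: "dg_state ?s n (run_rounds (dg_queries ?s) n (fg_answer n f g) k) = (v, w)"
    by fastforce
  have IH: "v \<in> cube n" "w \<in> cube n" "\<And>i. i < n \<Longrightarrow> w i - v i = 1 - (real k + 2) / real N"
    "(1 - 2 / real N) * f z \<le> potential ?s z v w"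
    using Suc.IH[OF _ vw] Suc.prems by auto
  have step: "dg_step n ?s v w (g v) (g w) = (x, y)"
    using dg_state_Suc[OF vw IH(1,2)] Suc.prems by simp
  have gap: "?s \<le> w i - v i" if "i < n" for i
    using IH(3)[OF that] Suc.prems(1) by (simp add: field_simps)
  have s: "0 \<le> ?s"
    by simp
  have *: "x \<in> cube n" "y \<in> cube n" "\<And>i. i < n \<Longrightarrow> y i - x i = w i - v i - ?s"
    "potential ?s z v w \<le> potential ?s z x y"
    using dg_step[OF IH(1,2) z s _ step] gap by auto
  have "y i - x i = 1 - (real (Suc k) + 2) / real N" if "i < n" for i
    using *(3)[OF that] IH(3)[OF that] by (simp add: diff_divide_distrib add_divide_distrib)
  with *(1,2,4) IH(4) show ?case
    by auto
qed

lemma dg_output: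
  assumes N: "2 \<le> N"
  defines "h \<equiv> run_rounds (dg_queries (1 / real N)) n (fg_answer n f g) (N - 2)"
  shows "fst (dg_state (1 / real N) n h) \<in> cube n"
    and "\<And>z. z \<in> cube n \<Longrightarrow> (1/2 - 1 / real N) * f z \<le> f (fst (dg_state (1 / real N) n h))"
proof -
  obtain x y where xy: "dg_state (1 / real N) n h = (x, y)"
    by fastforce
  have inv: "x \<in> cube n \<and> y \<in> cube n \<and> (\<forall>i<n. y i - x i = 0) \<and>
    (1 - 2 / real N) * f z \<le> potential (1 / real N) z x y" if "z \<in> cube n" for z
    using dg_invariant[OF that N _ xy[unfolded h_def]] N by (simp add: of_nat_diff)
  \<comment> \<open>\<open>inv\<close> speaks about a point \<open>z\<close> of the cube; any one
    serves to extract the facts about \<open>x\<close> and \<open>y\<close>.\<close>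
  have "diag n 0 \<in> cube n"
    by (simp add: diag_cube)
  from inv[OF this] have x: "x \<in> cube n" and "y = x"
    using cube_outside by (auto simp: fun_eq_iff) (metis not_le)
  then show "fst (dg_state (1 / real N) n h) \<in> cube n"
    by (simp add: xy)
  \<comment> \<open>With \<open>y\<close> = \<open>x\<close> the gradient difference vanishes and
    the potential is 2 * f x.\<close>
  have "project z x x = x" for z
    by (auto simp: project_def)
  then show "(1/2 - 1 / real N) * f z \<le> f (fst (dg_state (1 / real N) n h))" if "z \<in> cube n" for z
    using inv[OF that] \<open>y = x\<close> by (simp add: xy potential_def algebra_simps)
qed

end

section \<open>Choice of the step and counting of queries\<close>

theorem theorem1:
  shows "\<exists>C>0. \<forall>\<epsilon>::real. 0 < \<epsilon> \<and> \<epsilon> < 1 \<longrightarrow>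
    (\<exists>(R::nat) (Q::nat \<Rightarrow> history \<Rightarrow> point list) (Out::nat \<Rightarrow> history \<Rightarrow> point).
       real R \<le> C * ln (1 / \<epsilon>) / \<epsilon> \<and>
       (\<forall>n f g. nonneg_on_cube n f \<and> dr_submodular n f \<and> gradient_on_cube n f g \<longrightarrow>
          (let h = run_rounds Q n (fg_answer n f g) R in
             Out n h \<in> cube n \<and>
             (\<forall>z\<in>cube n. f (Out n h) \<ge> (1/2 - \<epsilon>) * f z) \<and>
             real (num_queries h) \<le> C * ln (1 / \<epsilon>) / \<epsilon>)))"
proof (intro exI[of _ "2 / ln 2"] conjI allI impI)
  show "0 < 2 / ln (2::real)"
    by simp
  fix \<epsilon> :: real
  assume \<epsilon>: "0 < \<epsilon> \<and> \<epsilon> < 1"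
  define N where "N = max 2 (nat \<lceil>1 / \<epsilon>\<rceil>)"
  define B where "B = 2 / ln 2 * ln (1 / \<epsilon>) / \<epsilon>"
  have N: "2 \<le> N" "1 / \<epsilon> \<le> real N"
    by (auto simp: N_def) linarith
  then have N_\<epsilon>: "1 / real N \<le> \<epsilon>"
    using \<epsilon> by (simp add: field_simps)
  have B: "2 * real (N - 2) \<le> B"
  \<comment> \<open>The bound tends to 0 as \<epsilon> tends to 1, so large \<epsilon> must do
    without queries: then N = 2 and no round takes place. For \<epsilon> < 1/2 the logarithm is at
    least ln 2, and the constant 2 / ln 2 turns this into room for the at most 2/\<epsilon>
    queries.\<close>
  proof (cases "1/2 \<le> \<epsilon>")
    case True
    then have "1 / \<epsilon> \<le> 2"
      using \<epsilon> by (simp add: field_simps)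
    then have "N = 2"
      by (simp add: N_def ceiling_le_iff)
    with \<epsilon> show ?thesis
      by (simp add: B_def)
  next
    case False
    then have "ln 2 \<le> ln (1 / \<epsilon>)"
      using \<epsilon> by (subst ln_le_cancel_iff) (auto simp: field_simps)
    then have "1 \<le> ln (1 / \<epsilon>) / ln 2"
      by simp
    then have "2 / \<epsilon> * 1 \<le> 2 / \<epsilon> * (ln (1 / \<epsilon>) / ln 2)"
      using \<epsilon> by (intro mult_left_mono) auto
    moreover have "real (N - 2) \<le> 1 / \<epsilon>"
      using \<epsilon> by (auto simp: N_def max_def of_nat_diff) linarith
    ultimately show ?thesis
      by (simp add: B_def mult_ac)
  qed
  have "fst (dg_state (1 / real N) n h) \<in> cube n \<and>
      (\<forall>z\<in>cube n. (1/2 - \<epsilon>) * f z \<le> f (fst (dg_state (1 / real N) n h))) \<and>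
      real (num_queries h) \<le> B"
    if "nonneg_on_cube n f \<and> dr_submodular n f \<and> gradient_on_cube n f g"
      and h: "h = run_rounds (dg_queries (1 / real N)) n (fg_answer n f g) (N - 2)"
    for n f g h
  proof -
    interpret dr_instance n f g
      using that(1) by unfold_locales auto
    have "(1/2 - \<epsilon>) * f z \<le> f (fst (dg_state (1 / real N) n h))" if "z \<in> cube n" for z
    proof -
      have "(1/2 - \<epsilon>) * f z \<le> (1/2 - 1 / real N) * f z"
        using N_\<epsilon> f_nonneg[OF that] by (intro mult_right_mono) auto
      also have "\<dots> \<le> f (fst (dg_state (1 / real N) n h))"
        using dg_output(2)[OF N(1) that] h by simp
      finally show ?thesis .
    qed
    with dg_output(1)[OF N(1)] B h show ?thesis
      by (simp add: num_queries_dg)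
  qed
  moreover have "real (N - 2) \<le> B"
    using B by simp
  ultimately show "\<exists>(R::nat) (Q::nat \<Rightarrow> history \<Rightarrow> point list) (Out::nat \<Rightarrow> history \<Rightarrow> point).
       real R \<le> 2 / ln 2 * ln (1 / \<epsilon>) / \<epsilon> \<and>
       (\<forall>n f g. nonneg_on_cube n f \<and> dr_submodular n f \<and> gradient_on_cube n f g \<longrightarrow>
          (let h = run_rounds Q n (fg_answer n f g) R in
             Out n h \<in> cube n \<and>
             (\<forall>z\<in>cube n. f (Out n h) \<ge> (1/2 - \<epsilon>) * f z) \<and>
             real (num_queries h) \<le> 2 / ln 2 * ln (1 / \<epsilon>) / \<epsilon>))"
    unfolding B_def[symmetric] Let_def
    by (intro exI[of _ "N - 2"] exI[of _ "dg_queries (1 / real N)"]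
        exI[of _ "\<lambda>n h. fst (dg_state (1 / real N) n h)"]) simp
qed

end
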